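(* Let $\pi_1,\ldots,\pi_n$ be composable processes, let $\mathcal{M}=(S,s^0,A,\mathtt{step},D,\mathtt{dom},\mathtt{obs})$ be the distributed machine obtained by composing them, and let $(D,\leadsto)$ be the implicit security policy of $\mathcal{M}$. Then $\mathcal{M}$ complies with $(D,\leadsto)$. That is, for every $\pi_i\in D$ and all $\alpha,\beta\in Exec(\mathcal{M})$, $$\mathtt{purge}_{\pi_i}(\alpha)=\mathtt{purge}_{\pi_i}(\beta)\implies \mathtt{obs}(\pi_i,s^0.\alpha)=\mathtt{obs}(\pi_i,s^0.\beta).$$
   Context: **Processes.** A process is a tuple $\pi=(S,s^0,A^{in},A^{out},\mathtt{step})$, where $S$ is a (possibly infinite) set of states with initial state $s^0$. The (possibly infinite) set of actions is $A=A^{in}\cup A^{out}$, consisting of receive actions $A^{in}$ and send actions $A^{out}$. The function $\mathtt{step}:S\times A\to S$ is a partial transition function; $\mathtt{step}(s,a)=\mathit{undef}$ means that $a$ cannot be executed from $s$. A send action is written $!_m$ (emission of message $m$). A receive action is written $?^{\pi}_m$ (reception of message $m$ in process $\pi$). **Composability.** Processes $\pi_1,\ldots,\pi_n$ with $\pi_i=(S_i,s_i^0,A_i^{in},A_i^{out},\mathtt{step}_i)$ are composable if for each message $m$ there is a unique $\pi_i$ with $!_m\in A_i^{out}$ (the sender of $m$) and at least one $\pi_j$ with $?^{\pi_j}_m\in A_j^{in}$ (a receiver of $m$). **Distributed machine.** The distributed machine obtained by composing $\pi_1,\ldots,\pi_n$ is $\mathcal{M}=(S,s^0,A,\mathtt{step},D,\mathtt{dom},\mathtt{obs})$,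 defined as follows. - $S=(S_1\times (A_1^{in})^* )\times\cdots\times(S_n\times (A_n^{in})^* )$ and $s^0=((s_1^0,\epsilon),\ldots,(s_n^0,\epsilon))$. A global state is $(q_1,\ldots,q_n)$ with $q_i=(s_i,\beta_i)$, where $s_i$ is the current state of $\pi_i$ and $\beta_i$ is its input buffer. In buffers, a message $m$ is identified with the receive action $?^{\pi_i}_m$. - $A=\bigcup_{i=1}^n (A_i^{in}\cup A_i^{out})$. - $\mathtt{step}$ is the partial function $S\times A\to S$ given by the following two rules, and is undefined otherwise. - Send: if $!_m\in A_i^{out}$ and $\mathtt{step}_i(s_i,!_m)\ne\mathit{undef}$, then $\mathtt{step}((q_1,\ldots,q_n),!_m)=(q_1',\ldots,q_n')$, where $q'_j=(\mathtt{step}_j(s_j,!_m),\beta_j)$ if $j=i$ and $?^{\pi_j}_m\notin A_j^{in}$; $q'_j=(s_j,\beta_j.m)$ if $j\neq i$ and $?^{\pi_j}_m\in A_j^{in}$; $q'_j=(\mathtt{step}_j(s_j,!_m),\beta_j.m)$ if $j=i$ and $?^{\pi_j}_m\in A_j^{in}$; and $q'_j=(s_j,\beta_j)$ otherwise. - Receive: if $?^{\pi_i}_m\in A_i^{in}$, $\mathtt{step}_i(s_i,?^{\pi_i}_m)\neq\mathit{undef}$, $\beta_i=\alpha_1.m.\alpha_2$, and $\mathtt{step}_i(s_i,?^{\pi_i}_b)=\mathit{undef}$ for every message $b$ occurring in $\alpha_1$, then $\mathtt{step}((q_1,\ldots,q_n),?^{\pi_i}_m)$ is obtained from $(q_1,\ldots,q_n)$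 by replacing the $i$-th component by $(\mathtt{step}_i(s_i,?^{\pi_i}_m),\alpha_1.\alpha_2)$. - $D=\{\pi_1,\ldots,\pi_n\}$; its elements are also called security domains. - $\mathtt{dom}:A\to D$, where $\mathtt{dom}(!_m)=\mathtt{dom}(?^{\pi_j}_m)$ is the unique sender of $m$. - $\mathtt{obs}(\pi_i,(q_1,\ldots,q_n))=q_i$. $Exec(\mathcal{M})$ is the set of finite sequences of actions executable from $s^0$, and $s^0.\alpha$ is the state reached from $s^0$ by executing $\alpha\in Exec(\mathcal{M})$. **Implicit security policy.** The implicit security policy of $\mathcal{M}$ is the pair $(D,\leadsto)$, where $\leadsto$ is a relation on $D$ (all edges are labelled $\top$, meaning that there are no filter functions). We have $\pi_i\leadsto\pi_j$ iff $i=j$ or there is a message $m$ with $!_m\in A_i^{out}$ and $?^{\pi_j}_m\in A_j^{in}$. **Purge.** For such a policy, $\mathtt{purge}_\pi$ is defined on finite sequences over $A$ by $\mathtt{purge}_\pi(\epsilon)=\epsilon$, $\mathtt{purge}_\pi(\alpha a)=\mathtt{purge}_\pi(\alpha)$ if $\mathtt{dom}(a)\not\leadsto\pi$, and $\mathtt{purge}_\pi(\alpha a)=\mathtt{purge}_\pi(\alpha)a$ otherwise. *)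

theory Defs
  imports "HOL-Library.FuncSet"
begin

text \<open>
  The composed processes \<open>\<pi>\<^sub>1, \<dots>, \<pi>\<^sub>n\<close> are a family \<open>P i\<close> with \<open>i \<in> {1..n}\<close>, and
  a process is referred to by its index: \<open>Recv i m\<close> is the reception of \<open>m\<close> in \<open>\<pi>\<^sub>i\<close>, and
  the security domains are the indices. All local state sets live in one ambient type
  \<open>'s\<close>; they are otherwise unrelated. The value \<open>None\<close> stands for ``undefined''.
\<close>

datatype 'm action = Send 'm | Recv nat 'm

record ('s, 'm) process =
  pstates :: "'s set"
  pinit :: 's
  ins :: "'m action set"
  outs :: "'m action set"
  pstep :: "'s \<Rightarrow> 'm action \<Rightarrow> 's option"

definition is_process :: "nat \<Rightarrow> ('s, 'm) process \<Rightarrow> bool" where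
  "is_process i p \<longleftrightarrow>
     pinit p \<in> pstates p \<and>
     ins p \<subseteq> range (Recv i) \<and>
     outs p \<subseteq> range Send \<and>
     (\<forall>s a t. pstep p s a = Some t \<longrightarrow> s \<in> pstates p \<and> a \<in> ins p \<union> outs p \<and> t \<in> pstates p)"

definition messages :: "nat \<Rightarrow> (nat \<Rightarrow> ('s, 'm) process) \<Rightarrow> 'm set" where
  "messages n P = {m. \<exists>i\<in>{1..n}. Send m \<in> outs (P i) \<or> Recv i m \<in> ins (P i)}"

definition composable :: "nat \<Rightarrow> (nat \<Rightarrow> ('s, 'm) process) \<Rightarrow> bool" where
  "composable n P \<longleftrightarrow>
     (\<forall>m\<in>messages n P.
        (\<exists>!i. i \<in> {1..n} \<and> Send m \<in> outs (P i)) \<and>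
        (\<exists>j\<in>{1..n}. Recv j m \<in> ins (P j)))"

definition sender :: "nat \<Rightarrow> (nat \<Rightarrow> ('s, 'm) process) \<Rightarrow> 'm \<Rightarrow> nat" where
  "sender n P m = (THE i. i \<in> {1..n} \<and> Send m \<in> outs (P i))"

record ('st, 'a, 'd, 'o) machine =
  states :: "'st set"
  init :: 'st
  actions :: "'a set"
  step :: "'st \<Rightarrow> 'a \<Rightarrow> 'st option"
  domains :: "'d set"
  dom_of :: "'a \<Rightarrow> 'd"
  obs :: "'d \<Rightarrow> 'st \<Rightarrow> 'o"

primrec run :: "('st, 'a, 'd, 'o) machine \<Rightarrow> 'st \<Rightarrow> 'a list \<Rightarrow> 'st option" where
  "run M s [] = Some s"
| "run M s (a # \<alpha>) = Option.bind (step M s a) (\<lambda>s'. run M s' \<alpha>)"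

definition Exec :: "('st, 'a, 'd, 'o) machine \<Rightarrow> 'a list set" where
  "Exec M = {\<alpha> \<in> lists (actions M). run M (init M) \<alpha> \<noteq> None}"

text \<open>The state \<open>s\<^sup>0.\<alpha>\<close>; meaningful only for \<open>\<alpha> \<in> Exec M\<close>.\<close>

definition reached :: "('st, 'a, 'd, 'o) machine \<Rightarrow> 'a list \<Rightarrow> 'st" where
  "reached M \<alpha> = the (run M (init M) \<alpha>)"

text \<open>A policy \<open>(D, \<leadsto>)\<close> is given by the relation \<open>\<leadsto>\<close> alone, \<open>D\<close> being \<open>domains M\<close>.\<close>

definition purge ::
  "('st, 'a, 'd, 'o) machine \<Rightarrow> ('d \<times> 'd) set \<Rightarrow> 'd \<Rightarrow> 'a list \<Rightarrow> 'a list" where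
  "purge M R u \<alpha> = filter (\<lambda>a. (dom_of M a, u) \<in> R) \<alpha>"

definition complies :: "('st, 'a, 'd, 'o) machine \<Rightarrow> ('d \<times> 'd) set \<Rightarrow> bool" where
  "complies M R \<longleftrightarrow>
     (\<forall>u\<in>domains M. \<forall>\<alpha>\<in>Exec M. \<forall>\<beta>\<in>Exec M.
        purge M R u \<alpha> = purge M R u \<beta> \<longrightarrow> obs M u (reached M \<alpha>) = obs M u (reached M \<beta>))"

text \<open>
  Global states are \<open>n\<close>-tuples, represented as functions on \<open>{1..n}\<close> that are \<open>undefined\<close>
  elsewhere. A message in the buffer of \<open>\<pi>\<^sub>i\<close> is stored as the receive action \<open>Recv i m\<close>.
\<close>

type_synonym ('s, 'm) gstate = "nat \<Rightarrow> 's \<times> 'm action list"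

definition gstates :: "nat \<Rightarrow> (nat \<Rightarrow> ('s, 'm) process) \<Rightarrow> ('s, 'm) gstate set" where
  "gstates n P = (\<Pi>\<^sub>E i\<in>{1..n}. pstates (P i) \<times> lists (ins (P i)))"

inductive gtrans ::
  "nat \<Rightarrow> (nat \<Rightarrow> ('s, 'm) process) \<Rightarrow>
     ('s, 'm) gstate \<Rightarrow> 'm action \<Rightarrow> ('s, 'm) gstate \<Rightarrow> bool"
  for n P where
  send: "gtrans n P q (Send m)
           (\<lambda>j\<in>{1..n}. (if j = i then t else fst (q j),
                        if Recv j m \<in> ins (P j) then snd (q j) @ [Recv j m] else snd (q j)))"
    if "q \<in> gstates n P" and "i \<in> {1..n}" and "Send m \<in> outs (P i)"
      and "pstep (P i) (fst (q i)) (Send m) = Some t"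
| receive: "gtrans n P q (Recv i m) (q(i := (t, \<alpha>\<^sub>1 @ \<alpha>\<^sub>2)))"
    if "q \<in> gstates n P" and "i \<in> {1..n}" and "Recv i m \<in> ins (P i)"
      and "pstep (P i) (fst (q i)) (Recv i m) = Some t"
      and "snd (q i) = \<alpha>\<^sub>1 @ Recv i m # \<alpha>\<^sub>2"
      and "\<forall>b\<in>set \<alpha>\<^sub>1. pstep (P i) (fst (q i)) b = None"

text \<open>The two rules define a partial function as soon as senders are unique.\<close>

lemma gtrans_deterministic:
  assumes comp: "composable n P" and "gtrans n P q a q'" and "gtrans n P q a q''"
  shows "q' = q''"
  using assms(2)
proof cases
  case (send i m t)
  note s1 = send
  show ?thesis
    using assms(3)
  proof cases
    case (send i' m' t')
    have "m \<in> messages n P" using s1 by (auto simp: messages_def)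
    then have "\<exists>!k. k \<in> {1..n} \<and> Send m \<in> outs (P k)"
      using comp by (auto simp: composable_def)
    then have "i' = i" using s1 send by auto
    moreover have "m' = m" using s1 send by simp
    moreover from calculation have "t' = t" using s1 send by simp
    ultimately show ?thesis using s1(2) send(2) by blast
  qed (use s1 in simp)
next
  case (receive i m t \<alpha>\<^sub>1 \<alpha>\<^sub>2)
  note r1 = receive
  show ?thesis
    using assms(3)
  proof cases
    case (receive i' m' t' \<beta>\<^sub>1 \<beta>\<^sub>2)
    have "Recv i m \<notin> set \<alpha>\<^sub>1" "Recv i m \<notin> set \<beta>\<^sub>1"
      using r1 receive by auto
    moreover have "\<alpha>\<^sub>1 @ Recv i m # \<alpha>\<^sub>2 = \<beta>\<^sub>1 @ Recv i m # \<beta>\<^sub>2"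
      using r1 receive by simp
    ultimately have "\<alpha>\<^sub>1 = \<beta>\<^sub>1 \<and> \<alpha>\<^sub>2 = \<beta>\<^sub>2"
      by (auto simp: append_eq_append_conv2 append_eq_Cons_conv Cons_eq_append_conv)
    with r1 receive show ?thesis by simp
  qed (use r1 in simp)
qed

definition gstep ::
  "nat \<Rightarrow> (nat \<Rightarrow> ('s, 'm) process) \<Rightarrow>
     ('s, 'm) gstate \<Rightarrow> 'm action \<Rightarrow> ('s, 'm) gstate option" where
  "gstep n P q a = (if \<exists>q'. gtrans n P q a q' then Some (THE q'. gtrans n P q a q') else None)"

lemma gstep_eq_Some_iff:
  assumes "composable n P"
  shows "gstep n P q a = Some q' \<longleftrightarrow> gtrans n P q a q'"
proof -
  have "(THE r. gtrans n P q a r) = r'" if "gtrans n P q a r'" for r'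
    using gtrans_deterministic[OF assms] that by blast
  then show ?thesis
    by (auto simp: gstep_def)
qed

primrec gdom :: "nat \<Rightarrow> (nat \<Rightarrow> ('s, 'm) process) \<Rightarrow> 'm action \<Rightarrow> nat" where
  "gdom n P (Send m) = sender n P m"
| "gdom n P (Recv j m) = sender n P m"

definition distributed_machine ::
  "nat \<Rightarrow> (nat \<Rightarrow> ('s, 'm) process) \<Rightarrow>
     (('s, 'm) gstate, 'm action, nat, 's \<times> 'm action list) machine" where
  "distributed_machine n P =
     \<lparr> states = gstates n P,
       init = (\<lambda>i\<in>{1..n}. (pinit (P i), [])),
       actions = (\<Union>i\<in>{1..n}. ins (P i) \<union> outs (P i)),
       step = gstep n P,
       domains = {1..n},
       dom_of = gdom n P,
       obs = (\<lambda>i q. q i) \<rparr>"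

definition implicit_policy :: "nat \<Rightarrow> (nat \<Rightarrow> ('s, 'm) process) \<Rightarrow> (nat \<times> nat) set" where
  "implicit_policy n P =
     {(i, j). i \<in> {1..n} \<and> j \<in> {1..n} \<and>
        (i = j \<or> (\<exists>m. Send m \<in> outs (P i) \<and> Recv j m \<in> ins (P j)))}"

end

(* The proof is an unwinding argument in the style of Rushby. An action whose domain may not
   interfere with a process leaves the local state and buffer of that process unchanged, and the
   effect of any executed action on the local component depends on that component only. Hence
   the component reached is determined by the purged sequence. *)

theory Submission
  imports Defs
begin

lemma run_append:
  "run M s (\<alpha> @ \<beta>) = Option.bind (run M s \<alpha>) (\<lambda>s'. run M s' \<beta>)"
  by (induction \<alpha> arbitrary: s) (simp_all add: bind_assoc)

text \<open>An empty purge means that the domain of every action of \<open>\<alpha>\<close> may not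
  interfere with \<open>u\<close>, so \<open>respect\<close> applies to each step in turn.\<close>

lemma obs_run_purge_Nil:
  assumes respect: "\<And>s a s'. step M s a = Some s' \<Longrightarrow> (dom_of M a, u) \<notin> R \<Longrightarrow> obs M u s' = obs M u s"
    and "run M s \<alpha> = Some s'" and "purge M R u \<alpha> = []"
  shows "obs M u s' = obs M u s"
  using assms(2,3)
proof (induction \<alpha> arbitrary: s)
  case (Cons a \<alpha>)
  then obtain r where "step M s a = Some r" "run M r \<alpha> = Some s'"
    by (auto simp: bind_eq_Some_conv)
  with Cons respect show ?case
    by (auto simp: purge_def split: if_splits)
qed simp

text \<open>Two runs are synchronised on the actions that survive purging. Both start states are
  arbitrary because the induction restarts from the states reached after each synchronised
  action.\<close>

lemma obs_run_eq_if_purge_eq: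
  assumes respect: "\<And>s a s'. step M s a = Some s' \<Longrightarrow> (dom_of M a, u) \<notin> R \<Longrightarrow> obs M u s' = obs M u s"
    and consistent: "\<And>s t a s' t'. step M s a = Some s' \<Longrightarrow> step M t a = Some t' \<Longrightarrow>
      obs M u s = obs M u t \<Longrightarrow> obs M u s' = obs M u t'"
    and "run M s \<alpha> = Some s'" and "run M t \<beta> = Some t'"
    and "purge M R u \<alpha> = purge M R u \<beta>" and "obs M u s = obs M u t"
  shows "obs M u s' = obs M u t'"
  using assms(3-)
proof (induction \<alpha> arbitrary: s t \<beta>)
  case Nil
  then have "obs M u t' = obs M u t"
    using obs_run_purge_Nil[of M u R t \<beta> t'] respect by (auto simp: purge_def)
  with Nil show ?case by simp
next
  case (Cons a \<alpha>)
  from Cons.prems obtain r where r: "step M s a = Some r" "run M r \<alpha> = Some s'"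
    by (auto simp: bind_eq_Some_conv)
  show ?case
  proof (cases "(dom_of M a, u) \<in> R")
    case False
    then show ?thesis
      using Cons.prems r respect[OF r(1)] by (intro Cons.IH[of r t \<beta>]) (auto simp: purge_def)
  next
    case True
    then have "purge M R u \<beta> = a # purge M R u \<alpha>"
      using Cons.prems by (simp add: purge_def)
    \<comment> \<open>The action \<open>a\<close> survives purging, so it heads the purged
      \<open>\<beta>\<close>; splitting \<open>\<beta>\<close> at its first surviving action leaves
      a prefix invisible to \<open>u\<close>.\<close>
    then obtain \<beta>\<^sub>1 \<beta>\<^sub>2 where \<beta>: "\<beta> = \<beta>\<^sub>1 @ a # \<beta>\<^sub>2" "purge M R u \<beta>\<^sub>1 = []"
        "purge M R u \<alpha> = purge M R u \<beta>\<^sub>2"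
      by (auto simp: purge_def filter_eq_Cons_iff filter_empty_conv)
    then obtain t\<^sub>1 t\<^sub>2 where t: "run M t \<beta>\<^sub>1 = Some t\<^sub>1" "step M t\<^sub>1 a = Some t\<^sub>2" "run M t\<^sub>2 \<beta>\<^sub>2 = Some t'"
      using Cons.prems(2) by (auto simp: run_append bind_eq_Some_conv)
    have "obs M u t\<^sub>1 = obs M u t"
      using obs_run_purge_Nil[of M u R t \<beta>\<^sub>1 t\<^sub>1] respect t(1) \<beta>(2) by blast
    then have "obs M u r = obs M u t\<^sub>2"
      using consistent[OF r(1) t(2)] Cons.prems by simp
    then show ?thesis
      using Cons.IH[OF r(2) t(3) \<beta>(3)] by simp
  qed
qed

text \<open>Membership in \<open>Exec\<close> makes both runs defined, so the second condition only
  has to compare states in which the action is executable.\<close>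

lemma complies_if_unwinding:
  assumes "\<And>u s a s'. u \<in> domains M \<Longrightarrow> step M s a = Some s' \<Longrightarrow> (dom_of M a, u) \<notin> R \<Longrightarrow>
      obs M u s' = obs M u s"
    and "\<And>u s t a s' t'. u \<in> domains M \<Longrightarrow> step M s a = Some s' \<Longrightarrow> step M t a = Some t' \<Longrightarrow>
      obs M u s = obs M u t \<Longrightarrow> obs M u s' = obs M u t'"
  shows "complies M R"
  unfolding complies_def
proof (intro ballI impI)
  fix u \<alpha> \<beta>
  assume u: "u \<in> domains M" and "\<alpha> \<in> Exec M" "\<beta> \<in> Exec M"
    and purge: "purge M R u \<alpha> = purge M R u \<beta>"
  then obtain s t where run: "run M (init M) \<alpha> = Some s" "run M (init M) \<beta> = Some t"
    unfolding Exec_def by blast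
  have "obs M u s = obs M u t"
    by (rule obs_run_eq_if_purge_eq[OF assms(1)[OF u] assms(2)[OF u] run purge refl])
  then show "obs M u (reached M \<alpha>) = obs M u (reached M \<beta>)"
    by (simp add: reached_def run)
qed

lemma sender_eqI:
  assumes "composable n P" and "i \<in> {1..n}" and "Send m \<in> outs (P i)"
  shows "sender n P m = i"
proof -
  have "m \<in> messages n P"
    using assms by (auto simp: messages_def)
  then have "\<exists>!i. i \<in> {1..n} \<and> Send m \<in> outs (P i)"
    using assms(1) by (simp add: composable_def)
  then show ?thesis
    unfolding sender_def using assms by (intro the1_equality) auto
qed

lemma sender_of_received:
  assumes "composable n P" and "i \<in> {1..n}" and "Recv i m \<in> ins (P i)"
  shows "sender n P m \<in> {1..n} \<and> Send m \<in> outs (P (sender n P m))"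
proof -
  have "m \<in> messages n P"
    using assms by (auto simp: messages_def)
  then have "\<exists>!i. i \<in> {1..n} \<and> Send m \<in> outs (P i)"
    using assms(1) by (simp add: composable_def)
  then show ?thesis
    unfolding sender_def by (rule theI')
qed

text \<open>A send alters only the sender and the receivers of its message, and the policy has an
  edge from the sender to each of them. A receive alters only the receiver, while its domain is the
  sender.\<close>

lemma gtrans_local_respect:
  assumes comp: "composable n P" and "gtrans n P q a q'" and i: "i \<in> {1..n}"
    and "(gdom n P a, i) \<notin> implicit_policy n P"
  shows "q' i = q i"
  using assms(2)
proof cases
  case (send k m t)
  then have "(k, i) \<notin> implicit_policy n P"
    using assms(4) sender_eqI[OF comp] by simp
  then show ?thesis
    using send i by (auto simp: implicit_policy_def)
next
  case (receive k m t \<alpha>\<^sub>1 \<alpha>\<^sub>2)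
  \<comment> \<open>If \<open>k = i\<close>, the message \<open>m\<close> itself would witness an
    edge from its sender to \<open>i\<close>.\<close>
  then have "k \<noteq> i"
    using assms(4) i sender_of_received[OF comp] by (auto simp: implicit_policy_def)
  then show ?thesis
    using receive by simp
qed

text \<open>The new local state is computed from the old one, and the buffer change depends only on
  the message and the old component.\<close>

lemma gtrans_step_consistent:
  assumes comp: "composable n P" and "gtrans n P q a q'" and "gtrans n P r a r'"
    and i: "i \<in> {1..n}" and eq: "q i = r i"
  shows "q' i = r' i"
  using assms(2)
proof cases
  case q: (send k m t)
  show ?thesis
    using assms(3)
  proof cases
    case r: (send k' m' t')
    \<comment> \<open>Uniqueness of the sender ensures that both transitions move the local state of
      the same process.\<close>
    have "k' = k"
      using q r sender_eqI[OF comp] by metis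
    then show ?thesis
      using q r i eq by auto
  qed (use q in simp)
next
  case q: (receive k m t \<alpha>\<^sub>1 \<alpha>\<^sub>2)
  show ?thesis
    using assms(3)
  proof cases
    case r: (receive k' m' t' \<beta>\<^sub>1 \<beta>\<^sub>2)
    show ?thesis
    proof (cases "k = i")
      case True
      \<comment> \<open>The reception of \<open>m\<close> is enabled in the common local state,
        whereas everything in the skipped prefixes is disabled there. Both splits are therefore at
        the first occurrence of \<open>m\<close> in the same buffer.\<close>
      have "Recv i m \<notin> set \<alpha>\<^sub>1" "Recv i m \<notin> set \<beta>\<^sub>1"
        using q r eq True by auto
      moreover have "\<alpha>\<^sub>1 @ Recv i m # \<alpha>\<^sub>2 = \<beta>\<^sub>1 @ Recv i m # \<beta>\<^sub>2"
        using q r eq True by simp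
      ultimately have "\<alpha>\<^sub>1 = \<beta>\<^sub>1 \<and> \<alpha>\<^sub>2 = \<beta>\<^sub>2"
        by (auto simp: append_eq_append_conv2 append_eq_Cons_conv Cons_eq_append_conv)
      then show ?thesis
        using q r eq True by simp
    qed (use q r eq in simp)
  qed (use q in simp)
qed

theorem proposition1:
  fixes n :: nat and P :: "nat \<Rightarrow> ('s, 'm) process"
  assumes "\<forall>i\<in>{1..n}. is_process i (P i)"
    and "composable n P"
  shows "complies (distributed_machine n P) (implicit_policy n P)"
proof (rule complies_if_unwinding)
  let ?M = "distributed_machine n P"
  \<comment> \<open>Composability makes transitions deterministic, so the definite description in
    \<open>gstep\<close> can be traded for the inductive relation.\<close>
  have step: "step ?M q a = Some q' \<longleftrightarrow> gtrans n P q a q'" for q a q'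
    by (simp add: distributed_machine_def gstep_eq_Some_iff[OF assms(2)])
  have sel: "domains ?M = {1..n}" "dom_of ?M = gdom n P" "obs ?M = (\<lambda>i q. q i)"
    by (simp_all add: distributed_machine_def)
  show "obs ?M i q' = obs ?M i q"
    if "i \<in> domains ?M" "step ?M q a = Some q'" "(dom_of ?M a, i) \<notin> implicit_policy n P"
    for i q a q'
    using gtrans_local_respect[OF assms(2)] that unfolding step sel by blast
  show "obs ?M i q' = obs ?M i r'"
    if "i \<in> domains ?M" "step ?M q a = Some q'" "step ?M r a = Some r'" "obs ?M i q = obs ?M i r"
    for i q r a q' r'
    using gtrans_step_consistent[OF assms(2)] that unfolding step sel by blast
qed

end
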